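(* Let $q$ be a prime power and $d\geq0$ an integer. Then \[ \mathcal{P}(q,d)\geq\sum_{k=1}^{\min\{d,q\}}\frac{q(q-1)\cdots(q-(k-1))}{kq^k}, \] with equality if and only if $d\geq q$. In particular, \[ \mathcal{P}(q,d)>\sum_{k=1}^{\min\{d,\lfloor\sqrt{q}\rfloor\}}\left(\frac{1}{k}\right)-\frac{1}{4}>\log\left(\min\{d,\lfloor\sqrt{q}\rfloor\}+1\right)-\frac{1}{4}. \]
   Context: For $f\in\mathbb{F}_q[x]$, the functional graph $\Gamma_f$ is the directed graph with vertex set $\mathbb{F}_q$ and an edge $\alpha\to\beta$ if and only if $f(\alpha)=\beta$. A $k$-cycle in $\Gamma_f$ is an orbit $\alpha_1\to\alpha_2\to\cdots\to\alpha_k\to\alpha_1$ under $f$ with $\alpha_1,\ldots,\alpha_k\in\mathbb{F}_q$ distinct (taken up to cyclic rotation); a cycle is a $k$-cycle for some $k\geq1$. The cycles of $\Gamma_f$ are in bijection with its connected components (connected components of the underlying undirected graph). $\mathcal{P}(q,d)$ denotes the average number of cycles: \[ \mathcal{P}(q,d)=\frac{\sum_{f\in\mathbb{F}_q[x],\,\deg f=d}\left|\{\text{cycles in }\Gamma_f\}\right|}{\left|\{f\in\mathbb{F}_q[x]:\deg f=d\}\right|}. \] $\log$ is the natural logarithm, and empty sums are $0$.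
   Formalization: As printed, the equality claim fails for d=q-1, q>2 (e.g. q=3, d=2, where both sides are 4/3), and the last strict inequality fails for d=0 (both sides are -1/4); proved here: equality iff d≥q, or q>2 and d=q-1, and the last inequality for d≥1. *)

theory Defs
  imports Complex_Main "HOL-Computational_Algebra.Polynomial" "HOL-Library.Cardinality"
begin

definition functional_graph :: "'a::comm_semiring_0 poly \<Rightarrow> ('a \<times> 'a) set" where
  "functional_graph f = {(\<alpha>, \<beta>). poly f \<alpha> = \<beta>}"

text \<open>
  A list of pairwise distinct vertices \<open>\<alpha>\<^sub>1, \<dots>, \<alpha>\<^sub>k\<close> with
  \<open>\<alpha>\<^sub>1 \<rightarrow> \<alpha>\<^sub>2 \<rightarrow> \<dots> \<rightarrow> \<alpha>\<^sub>k \<rightarrow> \<alpha>\<^sub>1\<close>. The index modulo the length supplies the closing edge;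
  a loop is the case \<open>k = 1\<close>.
\<close>
definition is_cycle_list :: "('a \<times> 'a) set \<Rightarrow> 'a list \<Rightarrow> bool" where
  "is_cycle_list G xs \<longleftrightarrow> xs \<noteq> [] \<and> distinct xs \<and>
     (\<forall>i < length xs. (xs ! i, xs ! (Suc i mod length xs)) \<in> G)"

definition rotation_rel :: "('a list \<times> 'a list) set" where
  "rotation_rel = {(xs, ys). \<exists>n. ys = rotate n xs}"

text \<open>A cycle is a class of such lists up to cyclic rotation.\<close>
definition graph_cycles :: "('a \<times> 'a) set \<Rightarrow> 'a list set set" where
  "graph_cycles G = {xs. is_cycle_list G xs} // rotation_rel"

text \<open>
  The zero polynomial has \<^term>\<open>degree 0 = 0\<close> in the library; it is excluded here, since
  its degree is not a natural number in the usual convention.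
\<close>
definition polys_of_degree :: "nat \<Rightarrow> 'a::zero poly set" where
  "polys_of_degree d = {f. f \<noteq> 0 \<and> degree f = d}"

text \<open>
  The average number of cycles \<open>\<P>(q, d)\<close>, where the field with \<open>q\<close> elements is the
  type \<open>'a\<close>. For a finite field both the set of polynomials and each set of cycles are finite.
\<close>
definition avg_cycles :: "'a::{field, finite} itself \<Rightarrow> nat \<Rightarrow> real" where
  "avg_cycles _ d =
     (\<Sum>f \<in> (polys_of_degree d :: 'a poly set). real (card (graph_cycles (functional_graph f))))
     / real (card (polys_of_degree d :: 'a poly set))"

end

theory Submission
  imports Defs
begin

text \<open>
  Expand the number of cycles as the sum of \<open>1 / k\<close> over the cyclic lists of length \<open>k\<close>, and count
  for each list the polynomials that realise it. A list of length \<open>k \<le> d\<close> is realised by exactly the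
  fraction \<open>1 / q ^ k\<close> of the polynomials of degree \<open>d\<close>, by interpolation, which gives the lower
  bound; equality holds if and only if no polynomial of degree \<open>d\<close> has a cycle of length greater than \<open>d\<close>.
  For \<open>d = q - 1 > 1\<close> such a cycle would be a permutation polynomial of degree \<open>q - 1\<close>, which does
  not exist. For \<open>d \<le> q - 2\<close> a cycle on \<open>d + 1\<close> points is interpolated in degree at most \<open>d\<close>, and one
  has to choose it such that the degree does not drop (for \<open>q = 4\<close>, \<open>d = 2\<close> every 3-cycle is affine, and
  a 4-cycle is used instead).
\<close>

section \<open>Polynomials of bounded degree and interpolation\<close>

text \<open>Coefficients are used instead of \<open>degree\<close> because the library gives 0 the
  degree 0. Over a field the set is then a space of dimension \<open>n\<close>, also for
  \<open>n = 0\<close>.\<close>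

definition polys_below :: "nat \<Rightarrow> 'a::zero poly set" where
  "polys_below n = {f. \<forall>i\<ge>n. coeff f i = 0}"

lemma polys_below_iff: "f \<in> polys_below n \<longleftrightarrow> f = 0 \<or> degree f < n"
  unfolding polys_below_def
  by (cases "f = 0") (auto simp: coeff_eq_0 dest!: spec[of _ "degree f"])

lemma polys_below_simps [simp]:
  "0 \<in> polys_below n"
  "pCons c f \<in> polys_below (Suc n) \<longleftrightarrow> f \<in> polys_below n"
proof -
  have "(\<forall>i\<ge>Suc n. coeff (pCons c f) i = 0) \<longleftrightarrow> (\<forall>i\<ge>n. coeff f i = 0)"
    by (metis Suc_le_D Suc_le_mono coeff_pCons_Suc)
  then show "pCons c f \<in> polys_below (Suc n) \<longleftrightarrow> f \<in> polys_below n"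
    by (simp add: polys_below_def)
qed (simp add: polys_below_def)

lemma polys_below_add: "f \<in> polys_below n \<Longrightarrow> g \<in> polys_below n \<Longrightarrow> f + g \<in> polys_below n"
  by (simp add: polys_below_def)

lemma polys_below_diff:
  "f \<in> polys_below n \<Longrightarrow> g \<in> polys_below n \<Longrightarrow> f - g \<in> polys_below n"
  for f :: "'a::ab_group_add poly"
  by (simp add: polys_below_def)

lemma polys_below_smult: "f \<in> polys_below n \<Longrightarrow> smult c f \<in> polys_below n"
  by (simp add: polys_below_def)

lemma polys_below_mono: "m \<le> n \<Longrightarrow> polys_below m \<subseteq> polys_below n"
  by (auto simp: polys_below_def)

lemma polys_of_degree_eq: "polys_of_degree d = polys_below (Suc d) - polys_below d"
  by (auto simp: polys_of_degree_def polys_below_iff)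

lemma polys_of_degree_iff_coeff:
  "f \<in> polys_below (Suc d) \<Longrightarrow> f \<in> polys_of_degree d \<longleftrightarrow> coeff f d \<noteq> 0"
  by (auto simp: polys_of_degree_eq polys_below_def) (metis le_antisym not_less_eq_eq)

lemma polys_below_Suc: "polys_below (Suc n) = (\<lambda>(c, f). pCons c f) ` (UNIV \<times> polys_below n)"
proof -
  have "f \<in> (\<lambda>(c, f). pCons c f) ` (UNIV \<times> polys_below n)" if "f \<in> polys_below (Suc n)" for f :: "'a poly"
    using that by (cases f) auto
  then show ?thesis by auto
qed

lemma finite_polys_below [simp]: "finite (polys_below n :: 'a::{zero, finite} poly set)"
proof (induction n)
  case 0
  have "(polys_below 0 :: 'a poly set) = {0}"
    by (auto simp: polys_below_iff)
  then show ?case by simp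
qed (simp add: polys_below_Suc)

lemma card_polys_below: "card (polys_below n :: 'a::{zero, finite} poly set) = CARD('a) ^ n"
proof (induction n)
  case 0
  have "(polys_below 0 :: 'a poly set) = {0}"
    by (auto simp: polys_below_iff)
  then show ?case by simp
next
  case (Suc n)
  have "inj_on (\<lambda>(c, f). pCons c f) (UNIV \<times> (polys_below n :: 'a poly set))"
    by (auto simp: inj_on_def)
  then show ?case
    by (simp add: polys_below_Suc card_image card_cartesian_product Suc)
qed

text \<open>
  Newton interpolation: prescribing the value at one point \<open>a\<close> amounts to writing
  \<open>f = g a + (x - a) h\<close>, where \<open>h\<close> runs over the polynomials of smaller degree with prescribed
  values at the remaining points.
\<close>
lemma card_interpolating:
  fixes g :: "'a::{field, finite} \<Rightarrow> 'a"
  assumes "card S \<le> n"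
  shows "card {f \<in> polys_below n. \<forall>s\<in>S. poly f s = g s} = CARD('a) ^ (n - card S)"
proof -
  have "finite S" by simp
  then show ?thesis using assms
  proof (induction S arbitrary: n g rule: finite_induct)
    case empty
    then show ?case by (simp add: card_polys_below)
  next
    case (insert a S)
    then obtain m where n: "n = Suc m" and m: "card S \<le> m"
      by (cases n) auto
    define g' where "g' s = (g s - g a) / (s - a)" for s
    define F where "F h = [:g a:] + [:-a, 1:] * h" for h :: "'a poly"
    let ?A = "{h \<in> polys_below m. \<forall>s\<in>S. poly h s = g' s}"
    let ?B = "{f \<in> polys_below n. \<forall>s\<in>insert a S. poly f s = g s}"
    have deg: "F h \<in> polys_below (Suc m) \<longleftrightarrow> h \<in> polys_below m" for h
    proof (cases "h = 0")
      case False
      have "degree ([:-a, 1:] * h) = Suc (degree h)"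
        using False by (subst degree_mult_eq) auto
      moreover from this have "degree (F h) = Suc (degree h)"
        unfolding F_def by (subst degree_add_eq_right) auto
      ultimately show ?thesis
        using False by (auto simp: polys_below_iff)
    qed (simp add: F_def)
    have vals: "(\<forall>s\<in>insert a S. poly (F h) s = g s) \<longleftrightarrow> (\<forall>s\<in>S. poly h s = g' s)" for h
    proof -
      have "poly (F h) s = g s \<longleftrightarrow> poly h s = g' s" if "s \<in> S" for s
      proof -
        have "s - a \<noteq> 0" using that insert.hyps by auto
        then show ?thesis by (auto simp: F_def g'_def field_simps)
      qed
      then show ?thesis by (simp add: F_def)
    qed
    have "bij_betw F ?A ?B"
    proof (rule bij_betwI')
      show "F x = F y \<longleftrightarrow> x = y" for x y
        by (simp add: F_def del: mult_pCons_left)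
      show "F h \<in> ?B" if "h \<in> ?A" for h
        using that vals[of h] deg[of h] n by simp
      fix f assume f: "f \<in> ?B"
      define h where "h = synthetic_div f a"
      have "f = F h"
        using synthetic_div_correct'[of a f] f by (simp add: h_def F_def add.commute)
      then show "\<exists>h\<in>?A. f = F h"
        using f vals[of h] deg[of h] n by blast
    qed
    then have "card ?B = card ?A" by (simp add: bij_betw_same_card)
    also have "\<dots> = CARD('a) ^ (m - card S)"
      using insert.IH[OF m] .
    finally show ?case using n insert.hyps by simp
  qed
qed

lemma CARD_ge_2: "CARD('a::{field, finite}) \<ge> 2"
  using card_mono[of UNIV "{0, 1 :: 'a}"] by simp

lemma interpolation_ex:
  fixes g :: "'a::{field, finite} \<Rightarrow> 'a"
  shows "\<exists>f\<in>polys_below (card S). \<forall>s\<in>S. poly f s = g s"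
proof -
  have "card {f \<in> polys_below (card S). \<forall>s\<in>S. poly f s = g s} = 1"
    by (simp add: card_interpolating)
  then have "{f \<in> polys_below (card S). \<forall>s\<in>S. poly f s = g s} \<noteq> {}"
    by force
  then show ?thesis by blast
qed

text \<open>Uniqueness comes from the same count as existence: with as many points as coefficients
  there is exactly one interpolant.\<close>

lemma polys_below_eqI:
  fixes f g :: "'a::{field, finite} poly"
  assumes "f \<in> polys_below (card S)" "g \<in> polys_below (card S)" "\<And>s. s \<in> S \<Longrightarrow> poly f s = poly g s"
  shows "f = g"
proof -
  have "card {h \<in> polys_below (card S). \<forall>s\<in>S. poly h s = poly g s} = 1"
    by (simp add: card_interpolating)
  then obtain h where "{h \<in> polys_below (card S). \<forall>s\<in>S. poly h s = poly g s} = {h}"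
    by (auto simp: card_1_singleton_iff)
  moreover have "f \<in> {h \<in> polys_below (card S). \<forall>s\<in>S. poly h s = poly g s}"
    "g \<in> {h \<in> polys_below (card S). \<forall>s\<in>S. poly h s = poly g s}"
    using assms by auto
  ultimately show ?thesis by simp
qed

text \<open>Values are prescribed by position, so that a cycle can be requested as
  \<open>ys = rotate1 xs\<close>; distinctness makes the lookup in \<open>map_of\<close>
  unambiguous.\<close>

lemma interpolation_list_ex:
  fixes xs ys :: "'a::{field, finite} list"
  assumes "distinct xs" "length ys = length xs"
  shows "\<exists>f\<in>polys_below (length xs). map (poly f) xs = ys"
proof -
  obtain f where f: "f \<in> polys_below (card (set xs))"
    "\<forall>s\<in>set xs. poly f s = the (map_of (zip xs ys) s)"
    using interpolation_ex[of "set xs" "\<lambda>s. the (map_of (zip xs ys) s)"] by blast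
  have "map (poly f) xs = ys"
  proof (rule nth_equalityI)
    fix i assume "i < length (map (poly f) xs)"
    then have i: "i < length xs" by simp
    then have "map_of (zip xs ys) (xs ! i) = Some (ys ! i)"
      using assms by (intro map_of_zip_nth) auto
    moreover have "poly f (xs ! i) = the (map_of (zip xs ys) (xs ! i))"
      using f(2) i by (blast intro: nth_mem)
    ultimately show "map (poly f) xs ! i = ys ! i"
      using i by (simp only: nth_map option.sel)
  qed (simp add: assms)
  then show ?thesis using f(1) distinct_card[OF assms(1)] by metis
qed

section \<open>Cycles as rotation classes of lists\<close>

text \<open>Passing to the successor on a cycle is a shift by one position, so the indices modulo
  the length become a single equation between lists.\<close>

lemma is_cycle_list_iff:
  "is_cycle_list (functional_graph f) xs \<longleftrightarrow> xs \<noteq> [] \<and> distinct xs \<and> map (poly f) xs = rotate1 xs"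
proof -
  have "map (poly f) xs = rotate1 xs \<longleftrightarrow>
      (\<forall>i<length xs. poly f (xs ! i) = xs ! (Suc i mod length xs))"
    unfolding list_eq_iff_nth_eq by (simp add: nth_rotate1)
  then show ?thesis
    by (simp only: is_cycle_list_def functional_graph_def mem_Collect_eq case_prod_conv)
qed

lemma equiv_rotation_rel: "equiv UNIV (rotation_rel :: ('a list \<times> 'a list) set)" (is "equiv _ ?r")
proof (rule equivI)
  show "refl ?r"
    by (auto simp: refl_on_def rotation_rel_def intro: exI[of _ 0])
  show "sym ?r"
  proof (rule symI)
    fix xs ys :: "'a list" assume "(xs, ys) \<in> rotation_rel"
    then obtain n where ys: "ys = rotate n xs" by (auto simp: rotation_rel_def)
    \<comment> \<open>The two rotations together make \<open>n * length xs\<close> steps, which is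
      the identity. Subtraction is truncated, hence the separate case of the empty list.\<close>
    have "rotate (n * length xs - n) ys = xs"
    proof (cases "xs = []")
      case False
      then have "n \<le> n * length xs" by (cases xs) auto
      then show ?thesis by (simp add: ys rotate_rotate)
    qed (simp add: ys)
    then show "(ys, xs) \<in> rotation_rel" by (auto simp: rotation_rel_def intro: sym)
  qed
  show "trans ?r"
    by (auto simp: trans_def rotation_rel_def rotate_rotate)
qed auto

text \<open>Rotations by fewer than \<open>length xs\<close> steps start with different entries, so
  they are pairwise different.\<close>

lemma card_rotation_class:
  assumes "distinct xs" "xs \<noteq> []"
  shows "card (rotation_rel `` {xs}) = length xs"
proof -
  have "rotation_rel `` {xs} = (\<lambda>n. rotate n xs) ` {..<length xs}"
  proof -
    have "rotate n xs \<in> (\<lambda>n. rotate n xs) ` {..<length xs}" for n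
      using assms by (subst rotate_conv_mod) auto
    then show ?thesis by (auto simp: rotation_rel_def)
  qed
  moreover have "inj_on (\<lambda>n. rotate n xs) {..<length xs}"
  proof (rule inj_onI)
    fix m n assume *: "m \<in> {..<length xs}" "n \<in> {..<length xs}" "rotate m xs = rotate n xs"
    then have "hd (rotate m xs) = hd (rotate n xs)" by simp
    then have "xs ! m = xs ! n"
      using * assms hd_rotate_conv_nth[of xs m] hd_rotate_conv_nth[of xs n] by simp
    then show "m = n" using * assms by (simp add: nth_eq_iff_index_eq)
  qed
  ultimately show ?thesis by (simp add: card_image)
qed

lemma finite_distinct_lists: "finite {xs :: 'a::finite list. distinct xs}"
proof (rule finite_subset)
  show "{xs :: 'a list. distinct xs} \<subseteq> {xs. set xs \<subseteq> UNIV \<and> length xs \<le> CARD('a)}"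
  proof
    fix xs :: "'a list" assume "xs \<in> {xs. distinct xs}"
    then show "xs \<in> {xs. set xs \<subseteq> UNIV \<and> length xs \<le> CARD('a)}"
      using card_mono[of UNIV "set xs"] by (simp add: distinct_card)
  qed
qed (rule finite_lists_length_le, simp)

text \<open>\<open>graph_cycles\<close> divides a set of lists by a relation on all lists, whereas
  the facts on quotients ask for an equivalence on that set.\<close>

lemma equiv_restrict: "equiv UNIV r \<Longrightarrow> equiv X (r \<inter> X \<times> X)"
  unfolding equiv_def refl_on_def sym_def trans_def by blast

text \<open>A class of lists of length \<open>k\<close> has \<open>k\<close> members of weight
  \<open>1 / k\<close>, hence total weight 1. The sum over lists is what double counting
  needs.\<close>

lemma card_graph_cycles:
  fixes f :: "'a::{field, finite} poly"
  shows "real (card (graph_cycles (functional_graph f)))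
    = (\<Sum>xs | is_cycle_list (functional_graph f) xs. 1 / real (length xs))"
proof -
  let ?X = "{xs. is_cycle_list (functional_graph f) xs}"
  let ?R = "rotation_rel \<inter> ?X \<times> ?X"
  have fin: "finite ?X"
    by (rule finite_subset[OF _ finite_distinct_lists]) (auto simp: is_cycle_list_def)
  \<comment> \<open>Cycle lists are closed under rotation, so restricting the relation to them
    leaves their classes unchanged.\<close>
  have rot: "rotate n xs \<in> ?X" if "xs \<in> ?X" for n xs
  proof -
    have "map (poly f) (rotate n xs) = rotate n (rotate1 xs)"
      using that by (metis is_cycle_list_iff mem_Collect_eq rotate_map)
    then show ?thesis
      using that by (simp add: is_cycle_list_iff rotate1_rotate_swap)
  qed
  have R_img: "?R `` {xs} = rotation_rel `` {xs}" if "xs \<in> ?X" for xs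
  proof -
    have "ys \<in> ?X" if "(xs, ys) \<in> rotation_rel" for ys
      using that rot[OF \<open>xs \<in> ?X\<close>] unfolding rotation_rel_def by blast
    then show ?thesis using that by blast
  qed
  have quot: "?X // ?R = graph_cycles (functional_graph f)"
    unfolding graph_cycles_def quotient_def using R_img by auto
  have eq: "equiv ?X ?R"
    by (rule equiv_restrict[OF equiv_rotation_rel])
  have "(\<Sum>xs\<in>?X. 1 / real (length xs)) = sum (\<lambda>xs. 1 / real (length xs)) (\<Union>(?X // ?R))"
    using Union_quotient[OF eq] by simp
  also have "\<dots> = (\<Sum>C\<in>?X // ?R. \<Sum>xs\<in>C. 1 / real (length xs))"
  proof (subst sum.Union_disjoint)
    show "\<forall>C\<in>?X // ?R. finite C"
      using finite_equiv_class[OF fin, of ?R] by blast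
    show "\<forall>A\<in>?X // ?R. \<forall>B\<in>?X // ?R. A \<noteq> B \<longrightarrow> A \<inter> B = {}"
      using quotient_disj[OF eq] by blast
  qed (simp only: o_def)
  also have "\<dots> = (\<Sum>C\<in>?X // ?R. 1)"
  proof (rule sum.cong)
    fix C assume "C \<in> ?X // ?R"
    then obtain xs where xs: "xs \<in> ?X" "C = rotation_rel `` {xs}"
      using R_img by (metis quotientE)
    then have ne: "xs \<noteq> []" "distinct xs" by (auto simp: is_cycle_list_def)
    have "(\<Sum>ys\<in>C. 1 / real (length ys)) = (\<Sum>ys\<in>C. 1 / real (length xs))"
      unfolding xs(2) by (rule sum.cong) (auto simp: rotation_rel_def)
    then show "(\<Sum>ys\<in>C. 1 / real (length ys)) = 1"
      using ne by (simp add: xs(2) card_rotation_class)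
  qed (rule refl)
  finally show ?thesis by (simp only: quot sum_constant mult_1_right)
qed

section \<open>The average as a sum over cyclic lists\<close>

text \<open>The cycle condition prescribes \<open>length xs\<close> values; an auxiliary interpolant
  \<open>g\<close> supplies them as a function of the points.\<close>

lemma card_cycle_list_polys_below:
  fixes xs :: "'a::{field, finite} list"
  assumes "distinct xs" "xs \<noteq> []" "length xs \<le> n"
  shows "card {f \<in> polys_below n. is_cycle_list (functional_graph f) xs} = CARD('a) ^ (n - length xs)"
proof -
  obtain g where g: "map (poly g) xs = rotate1 xs"
    using interpolation_list_ex[of xs "rotate1 xs"] assms by auto
  have "{f \<in> polys_below n. is_cycle_list (functional_graph f) xs}
      = {f \<in> polys_below n. \<forall>s\<in>set xs. poly f s = poly g s}"
    using assms by (auto simp: is_cycle_list_iff simp flip: g)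
  then show ?thesis
    using assms by (simp add: card_interpolating distinct_card)
qed

lemma card_polys_of_degree:
  "real (card (polys_of_degree d :: 'a::{field, finite} poly set))
    = real (CARD('a)) ^ Suc d - real (CARD('a)) ^ d"
proof -
  have "card (polys_of_degree d :: 'a poly set) = CARD('a) ^ Suc d - CARD('a) ^ d"
    unfolding polys_of_degree_eq
    by (subst card_Diff_subset) (simp_all add: polys_below_mono card_polys_below)
  then show ?thesis
    by (simp add: of_nat_diff)
qed

lemma card_polys_of_degree_pos: "card (polys_of_degree d :: 'a::{field, finite} poly set) > 0"
proof -
  have "real (CARD('a)) ^ d < real (CARD('a)) ^ Suc d"
    using CARD_ge_2[where 'a='a] by (intro power_strict_increasing) auto
  then have "real (card (polys_of_degree d :: 'a poly set)) > 0"
    by (simp add: card_polys_of_degree)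
  then show ?thesis by simp
qed

text \<open>With \<open>k = length xs\<close>, the bounded-degree counts for \<open>Suc d\<close>
  and \<open>d\<close> differ by \<open>q^(d+1-k) - q^(d-k)\<close>; the count for \<open>d\<close>
  is available because \<open>k \<le> d\<close>.\<close>

lemma card_cycle_list_polys_of_degree:
  fixes xs :: "'a::{field, finite} list"
  assumes "distinct xs" "xs \<noteq> []" "length xs \<le> d"
  shows "real (card {f \<in> polys_of_degree d. is_cycle_list (functional_graph f) xs})
    = real (card (polys_of_degree d :: 'a poly set)) / real (CARD('a)) ^ length xs"
proof -
  define C where "C n = {f \<in> polys_below n. is_cycle_list (functional_graph f) xs}" for n
  have "{f \<in> polys_of_degree d. is_cycle_list (functional_graph f) xs} = C (Suc d) - C d"
    by (auto simp: polys_of_degree_eq C_def)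
  moreover have "C d \<subseteq> C (Suc d)" "finite (C n)" for n
    using polys_below_mono[of d "Suc d"] by (auto simp: C_def)
  ultimately have "real (card {f \<in> polys_of_degree d. is_cycle_list (functional_graph f) xs})
      = real (card (C (Suc d))) - real (card (C d))"
    by (simp add: card_Diff_subset of_nat_diff card_mono)
  also have "\<dots> = real (CARD('a)) ^ (Suc d - length xs) - real (CARD('a)) ^ (d - length xs)"
    unfolding C_def using assms
    by (subst (1 2) card_cycle_list_polys_below) simp_all
  also have "\<dots> = real (card (polys_of_degree d :: 'a poly set)) / real (CARD('a)) ^ length xs"
    using assms by (simp add: card_polys_of_degree power_diff Suc_diff_le diff_divide_distrib)
  finally show ?thesis .
qed

lemma card_distinct_lists_length:
  assumes "k \<le> CARD('a::finite)"
  shows "real (card {xs :: 'a list. distinct xs \<and> length xs = k}) = (\<Prod>i<k. real (CARD('a)) - real i)"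
proof -
  have "{xs :: 'a list. distinct xs \<and> length xs = k} = {xs. length xs = k \<and> distinct xs \<and> set xs \<subseteq> UNIV}"
    by auto
  then have "card {xs :: 'a list. distinct xs \<and> length xs = k} = \<Prod>{CARD('a) - k + 1..CARD('a)}"
    using assms card_lists_distinct_length_eq[of "UNIV :: 'a set" k] by simp
  also have "\<dots> = (\<Prod>i<k. CARD('a) - i)"
    by (rule prod.reindex_bij_witness[of _ "\<lambda>i. CARD('a) - i" "\<lambda>i. CARD('a) - i"])
      (use assms in auto)
  finally show ?thesis
    using assms by (simp add: of_nat_diff)
qed

text \<open>These lists are too long for the interpolation count in degree \<open>d\<close>; they
  account for the excess of the average over the bound.\<close>

definition long_cycle_lists :: "nat \<Rightarrow> 'a::{field, finite} poly \<Rightarrow> 'a list set" where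
  "long_cycle_lists d f = {xs. is_cycle_list (functional_graph f) xs \<and> d < length xs}"

lemma length_distinct_le_CARD: "distinct (xs :: 'a::finite list) \<Longrightarrow> length xs \<le> CARD('a)"
  using card_mono[of UNIV "set xs"] by (simp add: distinct_card)

lemma finite_long_cycle_lists [simp]: "finite (long_cycle_lists d f)"
  by (rule finite_subset[OF _ finite_distinct_lists]) (auto simp: long_cycle_lists_def is_cycle_list_def)

lemma finite_polys_of_degree [simp]: "finite (polys_of_degree d :: 'a::{zero, finite} poly set)"
  by (simp add: polys_of_degree_eq)

text \<open>Exchanging the sums over polynomials and lists evaluates the lists of length at most
  \<open>d\<close> exactly. The others stay as a nonnegative remainder, from which both the bound
  and its equality case are read off.\<close>

lemma avg_cycles_eq:
  "avg_cycles TYPE('a::{field, finite}) d =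
      (\<Sum>k = 1..min d CARD('a). (\<Prod>i<k. real CARD('a) - real i) / (real k * real CARD('a) ^ k))
    + (\<Sum>f \<in> (polys_of_degree d :: 'a poly set). \<Sum>xs\<in>long_cycle_lists d f. 1 / real (length xs))
      / real (card (polys_of_degree d :: 'a poly set))"
proof -
  let ?P = "polys_of_degree d :: 'a poly set"
  let ?q = "real CARD('a)"
  let ?N = "real (card ?P)"
  have N: "?N > 0" using card_polys_of_degree_pos[of d, where 'a='a] by simp
  \<comment> \<open>The empty list belongs to \<open>D\<close> too. It is no cycle, and its terms
    with denominator 0 have the value 0, so \<open>k = 0\<close> can appear below and be dropped
    again.\<close>
  define D where "D = {xs :: 'a list. distinct xs \<and> length xs \<le> d}"
  define cyc where "cyc f xs \<longleftrightarrow> is_cycle_list (functional_graph f) xs" for f :: "'a poly" and xs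
  have finD: "finite D"
    by (rule finite_subset[OF _ finite_distinct_lists]) (auto simp: D_def)
  have cycles: "real (card (graph_cycles (functional_graph f)))
      = (\<Sum>xs\<in>D. if cyc f xs then 1 / real (length xs) else 0)
        + (\<Sum>xs\<in>long_cycle_lists d f. 1 / real (length xs))" for f :: "'a poly"
  proof -
    have *: "{xs. is_cycle_list (functional_graph f) xs} = {xs\<in>D. cyc f xs} \<union> long_cycle_lists d f"
      by (auto simp: D_def long_cycle_lists_def is_cycle_list_def cyc_def)
    show ?thesis
      unfolding card_graph_cycles * sum.inter_filter[OF finD, symmetric]
      by (rule sum.union_disjoint) (use finD in simp, simp, auto simp: D_def long_cycle_lists_def)
  qed
  have "(\<Sum>f\<in>?P. \<Sum>xs\<in>D. if cyc f xs then 1 / real (length xs) else 0)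
      = (\<Sum>xs\<in>D. \<Sum>f\<in>?P. if cyc f xs then 1 / real (length xs) else 0)"
    by (rule sum.swap)
  also have "\<dots> = (\<Sum>xs\<in>D. ?N / (real (length xs) * ?q ^ length xs))"
  proof (rule sum.cong)
    fix xs assume "xs \<in> D"
    then have xs: "distinct xs" "length xs \<le> d" by (auto simp: D_def)
    have "(\<Sum>f\<in>?P. if cyc f xs then 1 / real (length xs) else 0)
        = real (card {f\<in>?P. is_cycle_list (functional_graph f) xs}) / real (length xs)"
      by (simp add: sum.inter_filter[symmetric] cyc_def)
    then show "(\<Sum>f\<in>?P. if cyc f xs then 1 / real (length xs) else 0)
        = ?N / (real (length xs) * ?q ^ length xs)"
      using xs by (cases "xs = []") (simp_all add: card_cycle_list_polys_of_degree mult.commute)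
  qed (rule refl)
  also have "\<dots> = (\<Sum>k\<in>{0..min d CARD('a)}. \<Sum>xs | xs \<in> D \<and> length xs = k. ?N / (real (length xs) * ?q ^ length xs))"
    by (rule sum.group[symmetric]) (auto simp: finD, auto simp: D_def length_distinct_le_CARD)
  also have "\<dots> = (\<Sum>k\<in>{0..min d CARD('a)}. (\<Prod>i<k. ?q - real i) * (?N / (real k * ?q ^ k)))"
  proof (rule sum.cong)
    fix k assume k: "k \<in> {0..min d CARD('a)}"
    have "{xs. xs \<in> D \<and> length xs = k} = {xs. distinct xs \<and> length xs = k}"
      using k by (auto simp: D_def)
    then have "real (card {xs. xs \<in> D \<and> length xs = k}) = (\<Prod>i<k. ?q - real i)"
      using k by (simp add: card_distinct_lists_length)
    then show "(\<Sum>xs | xs \<in> D \<and> length xs = k. ?N / (real (length xs) * ?q ^ length xs))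
        = (\<Prod>i<k. ?q - real i) * (?N / (real k * ?q ^ k))"
      by simp
  qed (rule refl)
  also have "\<dots> = (\<Sum>k = 1..min d CARD('a). (\<Prod>i<k. ?q - real i) * (?N / (real k * ?q ^ k)))"
    by (rule sum.mono_neutral_right) auto
  also have "\<dots> = ?N * (\<Sum>k = 1..min d CARD('a). (\<Prod>i<k. ?q - real i) / (real k * ?q ^ k))"
    by (simp add: sum_distrib_left mult.commute)
  finally show ?thesis
    using N by (auto simp: avg_cycles_def cycles sum.distrib add_divide_distrib)
qed

lemma avg_cycles_ge:
  "avg_cycles TYPE('a::{field, finite}) d \<ge>
      (\<Sum>k = 1..min d CARD('a). (\<Prod>i<k. real CARD('a) - real i) / (real k * real CARD('a) ^ k))"
  by (simp add: avg_cycles_eq sum_nonneg)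

text \<open>Every long list has positive weight, so the remainder vanishes only if there are
  none.\<close>

lemma avg_cycles_eq_iff:
  "avg_cycles TYPE('a::{field, finite}) d =
      (\<Sum>k = 1..min d CARD('a). (\<Prod>i<k. real CARD('a) - real i) / (real k * real CARD('a) ^ k))
    \<longleftrightarrow> (\<forall>f \<in> (polys_of_degree d :: 'a poly set). long_cycle_lists d f = {})"
proof -
  let ?P = "polys_of_degree d :: 'a poly set"
  have "(\<Sum>f\<in>?P. \<Sum>xs\<in>long_cycle_lists d f. 1 / real (length xs)) = 0
    \<longleftrightarrow> (\<forall>f\<in>?P. (\<Sum>xs\<in>long_cycle_lists d f. 1 / real (length xs)) = 0)"
    by (rule sum_nonneg_eq_0_iff) (auto simp: sum_nonneg)
  also have "\<dots> \<longleftrightarrow> (\<forall>f\<in>?P. \<forall>xs\<in>long_cycle_lists d f. 1 / real (length xs) = 0)"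
    by (subst sum_nonneg_eq_0_iff) auto
  also have "\<dots> \<longleftrightarrow> (\<forall>f\<in>?P. long_cycle_lists d f = {})"
    by (auto simp: long_cycle_lists_def is_cycle_list_def)
  finally show ?thesis
    using card_polys_of_degree_pos[of d, where 'a='a] by (auto simp: avg_cycles_eq)
qed

section \<open>Elementary estimates of the sums\<close>

text \<open>Weierstrass product inequality: the loss is at most the sum of \<open>i / q\<close> over
  \<open>i < k\<close>. In the induction the product so far is at most 1, so the factor
  \<open>1 - k / q\<close> costs at most \<open>k / q\<close>.\<close>

lemma prod_one_minus_ge:
  fixes q :: real
  assumes "q > 0" "real k \<le> q"
  shows "(\<Prod>i<k. 1 - real i / q) \<ge> 1 - real k * (real k - 1) / (2 * q)"
  using assms
proof (induction k)
  case (Suc k)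
  let ?p = "\<Prod>i<k. 1 - real i / q"
  have "?p \<le> 1"
    using Suc.prems by (intro prod_le_1) (auto simp: field_simps)
  then have "?p * (real k / q) \<le> real k / q"
    using Suc.prems by (intro mult_left_le_one_le) (auto intro!: prod_nonneg simp: field_simps)
  moreover have "1 - real k * (real k - 1) / (2 * q) \<le> ?p"
    using Suc by simp
  moreover have "real k * (real k - 1) / (2 * q) + real k / q = real (Suc k) * (real (Suc k) - 1) / (2 * q)"
    using Suc.prems by (simp add: field_simps)
  ultimately show ?case
    by (simp add: algebra_simps)
qed simp

text \<open>After division by \<open>k\<close> the product inequality loses
  \<open>(k - 1) / (2 * q)\<close>. These losses add up to \<open>m * (m - 1) / (4 * q)\<close>,
  which is below \<open>1 / 4\<close> because \<open>m * m \<le> q\<close>.\<close>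

lemma sum_falling_factorial_gt:
  fixes q d :: nat
  assumes "q > 0"
  defines "m \<equiv> min d (nat \<lfloor>sqrt (real q)\<rfloor>)"
  shows "(\<Sum>k = 1..min d q. (\<Prod>i<k. real q - real i) / (real k * real q ^ k))
    > (\<Sum>k = 1..m. 1 / real k) - 1 / 4"
proof -
  have "real m \<le> real (nat \<lfloor>sqrt (real q)\<rfloor>)"
    unfolding m_def by (rule of_nat_mono) simp
  also have "\<dots> \<le> sqrt (real q)"
    by (rule of_nat_floor) simp
  finally have "real m ^ 2 \<le> real q"
    by (metis real_le_rsqrt of_nat_0_le_iff power_mono real_sqrt_pow2)
  then have m2: "m * m \<le> q"
    by (metis of_nat_le_iff of_nat_power power2_eq_square)
  have mq: "m \<le> q" using m2 by (cases m) auto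
  have gauss: "(\<Sum>k = 1..n. real k - 1) = real n * (real n - 1) / 2" for n
    by (induction n) (auto simp: field_simps)
  have quarter: "(\<Sum>k = 1..n. (real k - 1) / (2 * real q)) = real n * (real n - 1) / (4 * real q)" for n
    by (simp only: gauss flip: sum_divide_distrib)
  have "real m * (real m - 1) < real q"
  proof (cases m)
    case (Suc n)
    then have "m * n < m * m" by simp
    then have "m * n < q" using m2 by linarith
    then have "real m * real n < real q" by (metis of_nat_less_iff of_nat_mult)
    then show ?thesis using Suc by simp
  qed (use assms in simp)
  then have "real m * (real m - 1) / (4 * real q) < 1 / 4"
    using assms by (simp add: field_simps)
  then have "(\<Sum>k = 1..m. 1 / real k) - 1 / 4
      < (\<Sum>k = 1..m. 1 / real k) - (\<Sum>k = 1..m. (real k - 1) / (2 * real q))"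
    unfolding quarter by (rule diff_strict_left_mono)
  also have "\<dots> = (\<Sum>k = 1..m. 1 / real k - (real k - 1) / (2 * real q))"
    by (simp add: sum_subtractf)
  also have "\<dots> \<le> (\<Sum>k = 1..m. (\<Prod>i<k. real q - real i) / (real k * real q ^ k))"
  proof (rule sum_mono)
    fix k assume k: "k \<in> {1..m}"
    have "(\<Prod>i<k. real q - real i) / real q ^ k = (\<Prod>i<k. 1 - real i / real q)"
    proof -
      have "(\<Prod>i<k. 1 - real i / real q) = (\<Prod>i<k. (real q - real i) / real q)"
        using assms(1) by (simp add: diff_divide_distrib)
      then show ?thesis by (simp add: prod_dividef)
    qed
    moreover have "1 - real k * (real k - 1) / (2 * real q) \<le> (\<Prod>i<k. 1 - real i / real q)"
      using k mq assms by (intro prod_one_minus_ge) auto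
    ultimately have "(1 - real k * (real k - 1) / (2 * real q)) / real k
        \<le> (\<Prod>i<k. real q - real i) / real q ^ k / real k"
      by (intro divide_right_mono) auto
    then show "1 / real k - (real k - 1) / (2 * real q)
        \<le> (\<Prod>i<k. real q - real i) / (real k * real q ^ k)"
      using k assms by (simp add: diff_divide_distrib mult.commute)
  qed
  \<comment> \<open>The terms added beyond \<open>m\<close> are nonnegative because
    \<open>k \<le> q\<close>.\<close>
  also have "\<dots> \<le> (\<Sum>k = 1..min d q. (\<Prod>i<k. real q - real i) / (real k * real q ^ k))"
    using mq by (intro sum_mono2) (auto simp: m_def intro!: divide_nonneg_nonneg prod_nonneg)
  finally show ?thesis .
qed

text \<open>Strictness comes from \<open>ln 2 < 1\<close> at the start; each induction step only
  uses \<open>ln (1 + x) \<le> x\<close>.\<close>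

lemma ln_less_sum_inverse:
  assumes "m \<ge> 1"
  shows "ln (real (m + 1)) < (\<Sum>k = 1..m. 1 / real k)"
  using assms
proof (induction m rule: dec_induct)
  case base
  show ?case using ln_2_less_1 by simp
next
  case (step m)
  have "ln (real (Suc m + 1)) = ln (real (m + 1) * (1 + 1 / real (Suc m)))"
    by (rule arg_cong[of _ _ ln]) (simp add: field_simps)
  also have "\<dots> = ln (real (m + 1)) + ln (1 + 1 / real (Suc m))"
    by (intro ln_mult_pos add_pos_nonneg) auto
  also have "ln (1 + 1 / real (Suc m)) \<le> 1 / real (Suc m)"
    by (intro ln_add_one_self_le_self) simp
  finally show ?case using step by simp
qed

section \<open>Lagrange weights and the degree q - 1\<close>

text \<open>The barycentric weights of Lagrange interpolation with node set
  \<open>S\<close>.\<close>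

definition lagrange_weight :: "'a::field set \<Rightarrow> 'a \<Rightarrow> 'a" where
  "lagrange_weight S s = (\<Prod>t\<in>S - {s}. 1 / (s - t))"

text \<open>In Lagrange form \<open>f\<close> is a combination of the monic polynomials
  \<open>L s\<close> of degree \<open>d\<close>. A drop of the degree below \<open>d\<close> thus
  becomes a linear equation between the values.\<close>

lemma coeff_eq_sum_lagrange_weight:
  fixes f :: "'a::{field, finite} poly"
  assumes f: "f \<in> polys_below (Suc d)" and S: "card S = Suc d"
  shows "coeff f d = (\<Sum>s\<in>S. lagrange_weight S s * poly f s)"
proof -
  define L where "L s = (\<Prod>t\<in>S - {s}. [:-t, 1:])" for s
  have degL: "degree (L s) = d" if "s \<in> S" for s
    using that S by (simp add: L_def degree_prod_eq_sum_degree)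
  have coeffL: "coeff (L s) d = 1" if "s \<in> S" for s
    using lead_coeff_prod[of "\<lambda>t. [:-t, 1:]" "S - {s}"] degL[OF that] by (simp add: L_def)
  define g where "g = (\<Sum>s\<in>S. smult (lagrange_weight S s * poly f s) (L s))"
  have "g \<in> polys_below (card S)"
    using degL by (simp add: g_def S polys_below_def coeff_sum coeff_eq_0)
  moreover have "poly g u = poly f u" if u: "u \<in> S" for u
  proof -
    have "poly (L s) u = 0" if "s \<in> S - {u}" for s
      using that u by (auto simp: L_def poly_prod)
    then have "poly g u = lagrange_weight S u * poly f u * poly (L u) u"
      using u by (simp add: g_def poly_sum sum.remove)
    also have "lagrange_weight S u * poly (L u) u = (\<Prod>t\<in>S - {u}. 1)"
      unfolding lagrange_weight_def L_def poly_prod prod.distrib[symmetric]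
      by (rule prod.cong) auto
    then have "lagrange_weight S u * poly f u * poly (L u) u = poly f u"
      by (simp add: mult.assoc mult.commute mult.left_commute)
    finally show ?thesis .
  qed
  ultimately have "g = f"
    using f S by (intro polys_below_eqI[where S = S]) auto
  then have "coeff f d = coeff g d" by simp
  also have "\<dots> = (\<Sum>s\<in>S. lagrange_weight S s * poly f s)"
    by (simp add: g_def coeff_sum coeffL)
  finally show ?thesis .
qed

lemma lagrange_weight_nonzero: "lagrange_weight S (s :: 'a::{field, finite}) \<noteq> 0"
  by (auto simp: lagrange_weight_def)

text \<open>The polynomial permutes the points of its cycle.\<close>

lemma sum_cycle_list:
  assumes "is_cycle_list (functional_graph f) xs"
  shows "(\<Sum>s\<in>set xs. poly f s) = \<Sum>(set xs)"
proof -
  have *: "distinct xs" "map (poly f) xs = rotate1 xs"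
    using assms by (auto simp: is_cycle_list_iff)
  have "(\<Sum>s\<in>set xs. poly f s) = sum_list (rotate1 xs)"
    using * by (simp add: sum.distinct_set_conv_list)
  also have "\<dots> = sum_list xs"
    by (cases xs) (simp_all add: add.commute)
  finally show ?thesis
    using * by (simp add: sum.distinct_set_conv_list)
qed

text \<open>
  On the whole field all Lagrange weights are equal, so the coefficient of \<open>x ^ (q - 1)\<close> is
  proportional to the sum of all values, and this sum vanishes for permutations.
\<close>
lemma no_long_cycle_list_CARD_minus_1:
  fixes f :: "'a::{field, finite} poly"
  assumes q: "CARD('a) > 2" and f: "f \<in> polys_of_degree (CARD('a) - 1)"
  shows "long_cycle_lists (CARD('a) - 1) f = {}"
proof (rule ccontr)
  define d where "d = CARD('a) - 1"
  have d: "CARD('a) = Suc d" "d > 1" using q by (auto simp: d_def)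
  define c :: 'a where "c = lagrange_weight UNIV 0"
  have const: "lagrange_weight UNIV s = c" for s :: 'a
    unfolding lagrange_weight_def c_def
    by (rule prod.reindex_bij_witness[of _ "\<lambda>t. t + s" "\<lambda>t. t - s"]) auto
  have coeff: "coeff g d = c * (\<Sum>s\<in>UNIV. poly g s)" if "g \<in> polys_below (Suc d)" for g :: "'a poly"
    using coeff_eq_sum_lagrange_weight[OF that, of UNIV] d by (simp add: const sum_distrib_left)
  \<comment> \<open>Applied to the polynomial \<open>x\<close>, whose coefficient at
    \<open>d > 1\<close> is 0, the formula shows that the field elements sum to 0. This is where
    \<open>q > 2\<close> enters.\<close>
  have "[:0, 1:] \<in> (polys_below (Suc d) :: 'a poly set)"
    using d by (auto simp: polys_below_iff)
  moreover have "coeff [:0, 1 :: 'a:] d = 0"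
    using d by (intro coeff_eq_0) auto
  ultimately have sum0: "\<Sum>(UNIV :: 'a set) = 0"
    using coeff[of "[:0, 1:]"] lagrange_weight_nonzero[of UNIV "0 :: 'a"] by (simp add: c_def)
  assume "long_cycle_lists (CARD('a) - 1) f \<noteq> {}"
  then obtain xs where xs: "is_cycle_list (functional_graph f) xs" "length xs \<ge> CARD('a)"
    using d by (auto simp: long_cycle_lists_def)
  then have "card (set xs) \<ge> CARD('a)"
    by (simp add: is_cycle_list_def distinct_card)
  then have "set xs = UNIV"
    by (intro card_seteq) auto
  then have "(\<Sum>s\<in>UNIV. poly f s) = 0"
    using sum_cycle_list[OF xs(1)] sum0 by simp
  moreover have "f \<in> polys_of_degree d" using f by (simp add: d_def)
  then have "f \<in> polys_below (Suc d)" "coeff f d \<noteq> 0"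
    using polys_of_degree_iff_coeff[of f d] by (auto simp: polys_of_degree_eq)
  ultimately show False
    using coeff[of f] by simp
qed

section \<open>Existence of cycles longer than the degree\<close>

text \<open>This is the starting point of the indirect proofs below: the interpolant on
  \<open>d + 1\<close> points has degree at most \<open>d\<close>, and degree exactly
  \<open>d\<close> is excluded.\<close>

lemma interpolating_cycle_list_below:
  fixes xs :: "'a::{field, finite} list"
  assumes "\<forall>f \<in> (polys_of_degree d :: 'a poly set). long_cycle_lists d f = {}"
    and "distinct xs" "length xs = Suc d"
  shows "\<exists>f\<in>polys_below d. is_cycle_list (functional_graph f) xs"
proof -
  obtain f where f: "f \<in> polys_below (Suc d)" "map (poly f) xs = rotate1 xs"
    using interpolation_list_ex[of xs "rotate1 xs"] assms(2,3) by auto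
  then have cyc: "is_cycle_list (functional_graph f) xs"
    using assms(2,3) by (auto simp: is_cycle_list_iff)
  then have "xs \<in> long_cycle_lists d f"
    using assms(3) by (simp add: long_cycle_lists_def)
  then have "f \<in> polys_below d"
    using assms(1) f(1) by (auto simp: polys_of_degree_eq)
  then show ?thesis using cyc by blast
qed

text \<open>
  Let the last point \<open>c\<close> of the cycle vary: if all interpolants had degree less than \<open>d\<close>, every
  admissible \<open>c\<close> would be a root of a fixed polynomial of degree \<open>d\<close>.
\<close>
lemma ex_long_cycle_list_if_double_less:
  assumes "d \<ge> 2" "2 * d < CARD('a::{field, finite})"
  shows "\<exists>f \<in> (polys_of_degree d :: 'a poly set). long_cycle_lists d f \<noteq> {}"
proof (rule ccontr)
  assume "\<not> ?thesis"
  then have no_long: "\<forall>f \<in> (polys_of_degree d :: 'a poly set). long_cycle_lists d f = {}" by blast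
  obtain A :: "'a set" where "card A = d"
    using obtain_subset_with_card_n[of d "UNIV :: 'a set"] assms by auto
  then obtain as :: "'a list" where as: "distinct as" "length as = d"
    using finite_distinct_list[of A] distinct_card by fastforce
  then obtain a bs e where as_eq: "as = a # bs @ [e]"
    using assms by (cases as; cases "tl as" rule: rev_cases) auto
  define M where "M = (\<Prod>b\<in>set (a # bs). [:-b, 1:])"
  have card_abs: "card (set (a # bs)) = d - 1"
    using as distinct_card[of "a # bs"] by (auto simp: as_eq)
  have degM: "degree M = d - 1"
    using card_abs by (simp add: M_def degree_prod_eq_sum_degree del: list.set)
  have Mb: "poly M b = 0" if "b \<in> set (a # bs)" for b
    using that by (simp add: M_def poly_prod del: list.set)
  have Me: "poly M e \<noteq> 0"
    using as by (auto simp: M_def poly_prod as_eq)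
  have M0: "M \<noteq> 0" using Me by auto
  \<comment> \<open>\<open>h\<close> follows the cycle except for the value 0 at \<open>e\<close>.
    Adding \<open>c / poly M e\<close> times \<open>M\<close> corrects this value to
    \<open>c\<close> and changes nothing at the other points of \<open>as\<close>.\<close>
  obtain h where h: "h \<in> polys_below d" "map (poly h) as = bs @ [e, 0]"
    using interpolation_list_ex[of as "bs @ [e, 0]"] as by (auto simp: as_eq)
  \<comment> \<open>\<open>P\<close> vanishes at \<open>c\<close> exactly if the corrected
    polynomial sends \<open>c\<close> back to \<open>a\<close>. Its coefficient at \<open>d\<close>
    comes from \<open>pCons 0 M\<close> alone.\<close>
  define P where "P = h + smult (1 / poly M e) (pCons 0 M) - [:a:]"
  have "coeff P d = lead_coeff M / poly M e"
    using h(1) assms degM by (cases d) (auto simp: P_def polys_below_def coeff_pCons)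
  then have "coeff P d \<noteq> 0" using M0 Me by simp
  moreover have "degree P \<le> d"
  proof (rule degree_le, intro allI impI)
    fix i assume "d < i"
    then show "coeff P i = 0"
      using h(1) assms degM
      by (cases i) (auto simp: P_def polys_below_def coeff_pCons coeff_eq_0 split: nat.splits)
  qed
  ultimately have card_roots: "card {c. poly P c = 0} \<le> d"
    using card_poly_roots_bound[of P] by (metis coeff_0 le_trans)
  have "poly P c = 0" if c: "c \<notin> set as" for c
  proof -
    have "distinct (as @ [c])" "length (as @ [c]) = Suc d"
      using c as by auto
    then obtain f where f: "f \<in> polys_below d" "map (poly f) (as @ [c]) = rotate1 (as @ [c])"
      using interpolating_cycle_list_below[OF no_long] unfolding is_cycle_list_iff by blast
    define g where "g = h + smult (c / poly M e) M"
    have "M \<in> polys_below d"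
      using degM assms by (simp add: polys_below_iff)
    then have "g \<in> polys_below d"
      unfolding g_def by (intro polys_below_add polys_below_smult h(1))
    moreover have "map (poly g) as = map (poly f) as"
    proof -
      have "map (poly g) (a # bs) = map (poly h) (a # bs)"
        using Mb by (intro map_cong refl) (simp add: g_def)
      also have "\<dots> = map (poly f) (a # bs)"
        using f(2) h(2) by (simp add: as_eq)
      finally have "map (poly g) (a # bs) = map (poly f) (a # bs)" .
      moreover have "poly g e = poly f e"
        using f(2) h(2) Me by (simp add: as_eq g_def)
      ultimately show ?thesis by (simp add: as_eq)
    qed
    ultimately have "g = f"
      using f(1) as distinct_card[of as] by (intro polys_below_eqI[of _ "set as"]) auto
    moreover have "poly f c = a" using f(2) by (simp add: as_eq)
    ultimately have "poly g c = a" by simp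
    then show ?thesis
      by (simp add: P_def g_def mult_ac)
  qed
  \<comment> \<open>There are \<open>q - d\<close> points outside \<open>as\<close>, more than the
    \<open>d\<close> roots allowed, because \<open>2 * d < q\<close>.\<close>
  then have "- set as \<subseteq> {c. poly P c = 0}" by auto
  then have "card (- set as) \<le> d"
    using card_roots card_mono[of "{c. poly P c = 0}" "- set as"] by simp
  then show False
    using assms as by (simp add: card_Diff_subset Compl_eq_Diff_UNIV distinct_card)
qed

text \<open>
  Exchanging two consecutive points of the cycle gives a linear relation between three Lagrange
  weights. With at least five points these relations force all weights to be equal, and then
  the points sum to zero, which cannot hold for all sets of \<open>d + 1\<close> points.
\<close>
lemma ex_long_cycle_list_if_ge_4:
  assumes "d \<ge> 4" "d + 2 \<le> CARD('a::{field, finite})"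
  shows "\<exists>f \<in> (polys_of_degree d :: 'a poly set). long_cycle_lists d f \<noteq> {}"
proof (rule ccontr)
  assume "\<not> ?thesis"
  then have no_long: "\<forall>f \<in> (polys_of_degree d :: 'a poly set). long_cycle_lists d f = {}" by blast
  have weights0: "(\<Sum>s\<in>S. lagrange_weight S s * poly f s) = 0"
    if "f \<in> polys_below d" "card S = Suc d" for f :: "'a poly" and S
  proof -
    have "f \<in> polys_below (Suc d)" "coeff f d = 0"
      using that(1) by (auto simp: polys_below_def)
    then show ?thesis
      using coeff_eq_sum_lagrange_weight[of f d S] that(2) by simp
  qed
  \<comment> \<open>The interpolants of the two cycles differ only at \<open>p\<close>,
    \<open>a\<close> and \<open>b\<close>, by \<open>a - b\<close>, \<open>b - r\<close> and
    \<open>r - a\<close>. Both have degree below \<open>d\<close>, so the weighted sum of these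
    differences is 0.\<close>
  have swap: "lagrange_weight S p * (a - b) + lagrange_weight S a * (b - r) + lagrange_weight S b * (r - a) = 0"
    if dist: "distinct (p # a # b # r # zs)" and len: "length (p # a # b # r # zs) = Suc d"
      and S: "S = set (p # a # b # r # zs)" for S :: "'a set" and p a b r zs
  proof -
    have dist': "distinct (p # b # a # r # zs)" and len': "length (p # b # a # r # zs) = Suc d"
      using dist len by auto
    obtain g where g: "g \<in> polys_below d" "is_cycle_list (functional_graph g) (p # b # a # r # zs)"
      using interpolating_cycle_list_below[OF no_long dist' len'] by blast
    obtain f where f: "f \<in> polys_below d" "is_cycle_list (functional_graph f) (p # a # b # r # zs)"
      using interpolating_cycle_list_below[OF no_long dist len] by blast
    have fg: "poly f p = a" "poly f a = b" "poly f b = r"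
        "poly g p = b" "poly g b = a" "poly g a = r"
        "map (poly f) (r # zs) = map (poly g) (r # zs)"
      using f(2) g(2) by (auto simp: is_cycle_list_iff)
    have "poly f s = poly g s" if "s \<in> set (r # zs)" for s
      using fg(7) that unfolding map_eq_conv by blast
    then have rest: "(\<Sum>s\<in>set (r # zs). lagrange_weight S s * poly (f - g) s) = 0"
      by (intro sum.neutral) simp
    have S': "S = insert p (insert a (insert b (set (r # zs))))"
      by (simp add: S)
    have "card S = Suc d" unfolding S using dist len distinct_card by metis
    then have "0 = (\<Sum>s\<in>S. lagrange_weight S s * poly (f - g) s)"
      using weights0[OF polys_below_diff[OF f(1) g(1)]] by simp
    also have "\<dots> = lagrange_weight S p * poly (f - g) p + (lagrange_weight S a * poly (f - g) a
        + (lagrange_weight S b * poly (f - g) b + (\<Sum>s\<in>set (r # zs). lagrange_weight S s * poly (f - g) s)))"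
      using dist by (subst (2) S') (simp del: poly_diff)
    finally show ?thesis
      unfolding rest by (simp add: fg add.assoc)
  qed
  have weight_eq: "lagrange_weight S p = lagrange_weight S a"
    if "card S = Suc d" "p \<in> S" "a \<in> S" "p \<noteq> a" for S :: "'a set" and p a
  proof -
    obtain ys where ys: "set ys = S - {p, a}" "distinct ys"
      using finite_distinct_list[OF finite[of "S - {p, a}"]] by blast
    have "length ys = d - 1"
      using that ys distinct_card[of ys] by (simp add: card_Diff_subset)
    then obtain b r r' zs where ys_eq: "ys = b # r # r' # zs"
      using assms(1) by (cases ys; cases "tl ys"; cases "tl (tl ys)") auto
    let ?w = "lagrange_weight S"
    \<comment> \<open>Keeping \<open>p\<close>, \<open>a\<close>, \<open>b\<close> and exchanging
      \<open>r\<close> with \<open>r'\<close> gives a second relation; the difference of the two is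
      \<open>(?w b - ?w a) * (r - r') = 0\<close>.\<close>
    have e: "?w p * (a - b) + ?w a * (b - r) + ?w b * (r - a) = 0"
      by (rule swap[where zs = "r' # zs"])
        (use that ys ys_eq \<open>length ys = d - 1\<close> assms in auto)
    have e': "?w p * (a - b) + ?w a * (b - r') + ?w b * (r' - a) = 0"
      by (rule swap[where zs = "r # zs"])
        (use that ys ys_eq \<open>length ys = d - 1\<close> assms in auto)
    have "(?w b - ?w a) * (r - r') = 0"
      using e e' by algebra
    then have "?w b = ?w a"
      using ys ys_eq by auto
    then have "(?w p - ?w a) * (a - b) = 0"
      using e by (simp add: algebra_simps)
    moreover have "a \<noteq> b" using ys ys_eq by auto
    ultimately show ?thesis by auto
  qed
  have sum_eq_0: "\<Sum>S = 0" if card: "card S = Suc d" for S :: "'a set"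
  proof -
    obtain xs where xs: "set xs = S" "distinct xs"
      using finite_distinct_list[of S] by auto
    then have "length xs = Suc d" using card distinct_card by metis
    then obtain f where f: "f \<in> polys_below d" "is_cycle_list (functional_graph f) xs"
      using interpolating_cycle_list_below[OF no_long] xs by blast
    obtain c where c: "c \<in> S" using card by fastforce
    have "0 = (\<Sum>s\<in>S. lagrange_weight S s * poly f s)"
      using weights0[OF f(1) card] by simp
    also have "\<dots> = (\<Sum>s\<in>S. lagrange_weight S c * poly f s)"
      by (intro sum.cong refl) (use weight_eq[OF card] c in metis)
    also have "\<dots> = lagrange_weight S c * \<Sum>S"
      using sum_cycle_list[OF f(2)] xs by (simp flip: sum_distrib_left)
    finally show ?thesis
      by (simp add: lagrange_weight_nonzero)
  qed
  \<comment> \<open>Replacing one point of \<open>S\<close> by a point outside keeps the size but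
    changes the sum, so the two sums cannot both be 0.\<close>
  obtain S :: "'a set" where S: "card S = Suc d"
    using obtain_subset_with_card_n[of "Suc d" "UNIV :: 'a set"] assms by auto
  obtain x where x: "x \<in> S" using S by fastforce
  have "S \<noteq> UNIV" using S assms by auto
  then obtain y where y: "y \<notin> S" by blast
  have "card (insert y (S - {x})) = Suc d"
    using x y S by (simp add: card_Diff_singleton)
  then have "y + \<Sum>(S - {x}) = 0"
    using sum_eq_0 y by fastforce
  moreover have "x + \<Sum>(S - {x}) = 0"
    using sum_eq_0[OF S] x by (simp add: sum.remove)
  ultimately show False using x y by (metis add_right_cancel)
qed

section \<open>Small fields\<close>

text \<open>The shift by 1 permutes the ring and so preserves the sum of all elements.\<close>

lemma of_nat_CARD_eq_0: "of_nat CARD('a) = (0 :: 'a::{ring_1, finite})"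
proof -
  have "(\<Sum>x\<in>UNIV. x + 1 :: 'a) = (\<Sum>x\<in>UNIV. x)"
    by (rule sum.reindex_bij_witness[of _ "\<lambda>x. x - 1" "\<lambda>x. x + 1"]) auto
  then show ?thesis by (simp add: sum.distrib)
qed

lemma ex_not_in_small_list:
  assumes "length xs < CARD('a::finite)"
  shows "\<exists>x::'a. x \<notin> set xs"
proof -
  have "card (set xs) < CARD('a)"
    using card_length[of xs] assms by linarith
  then show ?thesis by (metis UNIV_eq_I less_irrefl)
qed

text \<open>Multiplication by \<open>a\<close> permutes the nonzero elements and so preserves their
  product.\<close>

lemma power_CARD_minus_1:
  fixes a :: "'a::{field, finite}"
  assumes "a \<noteq> 0"
  shows "a ^ (CARD('a) - 1) = 1"
proof -
  have "(\<Prod>x\<in>-{0}. a * x) = (\<Prod>x\<in>-{0}. x)"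
    by (rule prod.reindex_bij_witness[of _ "\<lambda>x. x / a" "\<lambda>x. a * x"]) (use assms in auto)
  then have "a ^ card (-{0 :: 'a}) * (\<Prod>x\<in>-{0}. x) = (\<Prod>x\<in>-{0}. x)"
    by (simp add: prod.distrib)
  then show ?thesis by (simp add: card_Diff_subset Compl_eq_Diff_UNIV)
qed

text \<open>This excludes the pair \<open>d = 3\<close>, \<open>q = 6\<close>, which no existence
  argument here covers. The characteristic would be 2 or 3, and all nonzero elements would satisfy
  \<open>x ^ 5 = 1\<close>.\<close>

lemma CARD_neq_6: "CARD('a::{field, finite}) \<noteq> 6"
proof
  assume q: "CARD('a) = 6"
  have pow5: "x ^ 5 = 1" if "x \<noteq> 0" for x :: 'a
    using power_CARD_minus_1[OF that] q by simp
  have "(2 :: 'a) * 3 = 0"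
    using of_nat_CARD_eq_0[where 'a='a] by (simp add: q)
  then consider "(2 :: 'a) = 0" | "(2 :: 'a) \<noteq> 0" "(3 :: 'a) = 0"
    unfolding mult_eq_0_iff by blast
  then show False
  proof cases
    case 1
    obtain w :: 'a where w: "w \<noteq> 0" "w \<noteq> 1"
      using ex_not_in_small_list[of "[0, 1 :: 'a]"] q by auto
    have "w + 1 \<noteq> 0"
    proof
      assume "w + 1 = 0"
      moreover have "w = w + 1 + 1 - 2" by simp
      ultimately show False using 1 w by simp
    qed
    then have "(w + 1) ^ 5 = 1" by (rule pow5)
    moreover have "(w + 1) ^ 5 = w ^ 5 + w ^ 4 + w + 1 + 2 * (2 * w ^ 4 + 5 * w ^ 3 + 5 * w ^ 2 + 2 * w)"
      by (simp add: eval_nat_numeral algebra_simps)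
    ultimately have "w ^ 4 + w + 1 = 0"
      using pow5[OF w(1)] 1 by (simp add: algebra_simps)
    moreover have "w * (w ^ 4 + w + 1) = w ^ 5 + w ^ 2 + w"
      by (simp add: eval_nat_numeral algebra_simps)
    ultimately have w2: "1 + w ^ 2 + w = 0"
      using pow5[OF w(1)] by simp
    \<comment> \<open>Division of \<open>w ^ 5\<close> by \<open>w ^ 2 + w + 1\<close> leaves the
      remainder \<open>w ^ 2\<close>.\<close>
    have "w ^ 5 = (1 + w ^ 2 + w) * (w ^ 3 - w ^ 2) + w ^ 2"
      by (simp add: eval_nat_numeral algebra_simps)
    then have "w ^ 2 = 1" using w2 pow5[OF w(1)] by simp
    then have "2 + w = 0" using w2 by (simp add: add.assoc[symmetric])
    then show False using 1 w by simp
  next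
    case 2
    have "(-1 :: 'a) = 1" using pow5[of "-1"] by simp
    then have "(1 :: 'a) + 1 = 0" by (metis add.right_inverse)
    then show False using 2 by simp
  qed
qed

lemma ex_long_cycle_listI:
  fixes f :: "'a::{field, finite} poly"
  assumes "f \<in> polys_of_degree d" "distinct xs" "map (poly f) xs = rotate1 xs" "d < length xs"
  shows "\<exists>f \<in> (polys_of_degree d :: 'a poly set). long_cycle_lists d f \<noteq> {}"
proof -
  have "xs \<in> long_cycle_lists d f"
    using assms by (auto simp: long_cycle_lists_def is_cycle_list_iff)
  then show ?thesis using assms(1) by blast
qed

text \<open>For a primitive cube root of unity \<open>w\<close>, the polynomial
  \<open>w * x ^ 2 + 1\<close> permutes the whole field in one 4-cycle.\<close>

lemma ex_long_cycle_list_CARD_4: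
  assumes q: "CARD('a::{field, finite}) = 4"
  shows "\<exists>f \<in> (polys_of_degree 2 :: 'a poly set). long_cycle_lists 2 f \<noteq> {}"
proof -
  have "(2 :: 'a) * 2 = 0"
    using of_nat_CARD_eq_0[where 'a='a] by (simp add: q)
  then have two: "(2 :: 'a) = 0" unfolding mult_eq_0_iff by blast
  then have m: "x + x = 0" for x :: 'a
    by (metis mult_2 mult_zero_left)
  obtain w :: 'a where w: "w \<noteq> 0" "w \<noteq> 1"
    using ex_not_in_small_list[of "[0, 1 :: 'a]"] q by auto
  have "w ^ 3 = 1" using power_CARD_minus_1[OF w(1)] q by simp
  then have "(w - 1) * (w * w + w + 1) = 0"
    by (simp add: eval_nat_numeral algebra_simps)
  then have w2: "w * w + w + 1 = 0" using w by simp
  have w1: "w + 1 \<noteq> 0" using w w2 by (auto simp: add.assoc)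
  have "map (poly [:1, 0, w:]) [0, 1, w + 1, w] = rotate1 [0, 1, w + 1, w]"
  proof -
    have "1 + w * (w + 1) * (w + 1) = (w * w + w + 1) * (w + 1) - w"
      by (simp add: algebra_simps)
    also have "\<dots> = w" using two w2 m[of w] by (simp add: eq_neg_iff_add_eq_0)
    finally have "poly [:1, 0, w:] (w + 1) = w" by (simp add: algebra_simps)
    moreover have "poly [:1, 0, w:] w = w ^ 3 + 1"
      by (simp add: eval_nat_numeral algebra_simps)
    then have "poly [:1, 0, w:] w = 0" using \<open>w ^ 3 = 1\<close> two by simp
    ultimately show ?thesis by (simp add: add.commute)
  qed
  moreover have dist: "distinct [0, 1, w + 1, w]" using w w1 by auto
  moreover have "[:1, 0, w:] \<in> polys_of_degree 2"
    using w by (simp add: polys_of_degree_def)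
  ultimately show ?thesis
    by (intro ex_long_cycle_listI[where xs = "[0, 1, w + 1, w]"]) auto
qed

lemma ex_long_cycle_list_CARD_5:
  assumes q: "CARD('a::{field, finite}) = 5"
  shows "\<exists>f \<in> (polys_of_degree 3 :: 'a poly set). long_cycle_lists 3 f \<noteq> {}"
proof -
  have five: "(5 :: 'a) = 0"
    using of_nat_CARD_eq_0[where 'a='a] by (simp add: q)
  have "(2 :: 'a) \<noteq> 0"
  proof
    assume "(2 :: 'a) = 0"
    then have "(5 :: 'a) - 2 * 2 = 0" using five by simp
    then show False by simp
  qed
  moreover have "(3 :: 'a) \<noteq> 0"
  proof
    assume "(3 :: 'a) = 0"
    then have "2 * 3 - (5 :: 'a) = 0" using five by simp
    then show False by simp
  qed
  ultimately have "distinct [0, 1, 2, 3 :: 'a]"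
    using right_minus_eq[of 2 "1 :: 'a"] right_minus_eq[of 3 "1 :: 'a"] right_minus_eq[of 3 "2 :: 'a"]
    by auto
  \<comment> \<open>The cubic is \<open>(x - 1) ^ 3 + 2\<close>, with integer values 1, 2, 3, 10 at
    0, 1, 2, 3; modulo 5 the last one is 0.\<close>
  moreover have "map (poly [:1, 3, -3, 1:]) [0, 1, 2, 3] = rotate1 [0, 1, 2, 3 :: 'a]"
  proof -
    have "(10 :: 'a) = 5 * 2" by simp
    then show ?thesis using five by simp
  qed
  moreover have "[:1, 3, -3, 1 :: 'a:] \<in> polys_of_degree 3"
    by (simp add: polys_of_degree_def)
  ultimately show ?thesis
    by (intro ex_long_cycle_listI[where xs = "[0, 1, 2, 3]"]) auto
qed

lemma no_long_cycle_list_iff: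
  "(\<forall>f \<in> (polys_of_degree d :: 'a::{field, finite} poly set). long_cycle_lists d f = {})
    \<longleftrightarrow> d \<ge> CARD('a) \<or> (CARD('a) > 2 \<and> d = CARD('a) - 1)"
  (is "?L \<longleftrightarrow> ?R")
proof
  assume ?R
  then show ?L
  proof
    assume d: "d \<ge> CARD('a)"
    show ?L
      using d length_distinct_le_CARD[where 'a='a]
      by (fastforce simp: long_cycle_lists_def is_cycle_list_def)
  qed (use no_long_cycle_list_CARD_minus_1 in blast)
next
  show ?R if ?L
  proof (rule ccontr)
    assume "\<not> ?R"
    then have d: "d < CARD('a)" "CARD('a) > 2 \<Longrightarrow> d + 2 \<le> CARD('a)"
      by auto
    have "\<exists>f \<in> (polys_of_degree d :: 'a poly set). long_cycle_lists d f \<noteq> {}"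
    \<comment> \<open>The constant 1 has a loop at 1, and \<open>1 - x\<close> exchanges 0 and 1.
      This settles \<open>q = 2\<close> entirely.\<close>
    proof (cases "d = 0 \<or> d = 1")
      case True
      then show ?thesis
      proof
        assume "d = 0"
        then show ?thesis
          by (intro ex_long_cycle_listI[where f = 1 and xs = "[1]"]) (auto simp: polys_of_degree_def)
      next
        assume "d = 1"
        then show ?thesis
          by (intro ex_long_cycle_listI[where f = "[:1, -1:]" and xs = "[0, 1]"])
            (auto simp: polys_of_degree_def)
      qed
    next
      case False
      then have d2: "d \<ge> 2" "d + 2 \<le> CARD('a)" using d by auto
      \<comment> \<open>For \<open>d = 2\<close> only \<open>q = 4\<close> escapes
        \<open>2 * d < q\<close>; for \<open>d = 3\<close> only \<open>q = 5\<close> and the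
        impossible \<open>q = 6\<close> do.\<close>
      consider "d \<ge> 4" | "2 * d < CARD('a)" | "d = 2" "CARD('a) = 4" | "d = 3" "CARD('a) = 5"
        using d2 CARD_neq_6[where 'a='a] by linarith
      then show ?thesis
        using d2 ex_long_cycle_list_if_ge_4 ex_long_cycle_list_if_double_less
          ex_long_cycle_list_CARD_4 ex_long_cycle_list_CARD_5
        by cases blast+
    qed
    then show False using that by blast
  qed
qed

text \<open>Equality also holds at \<open>d = q - 1\<close> when \<open>q > 2\<close>, so
  \<open>d \<ge> q\<close> alone would be false; for \<open>q = 2\<close> the polynomial
  \<open>x + 1\<close> has a 2-cycle and equality fails at \<open>d = 1\<close>. At
  \<open>d = 0\<close> both sides of the logarithmic bound are \<open>- 1 / 4\<close>, hence the
  premise \<open>d \<ge> 1\<close> there.\<close>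

theorem corollary2p3:
  fixes q d :: nat
  assumes "CARD('a::{field, finite}) = q"
  shows
    "avg_cycles TYPE('a) d
        \<ge> (\<Sum>k = 1..min d q. (\<Prod>i<k. real q - real i) / (real k * real q ^ k))
     \<and> (avg_cycles TYPE('a) d
          = (\<Sum>k = 1..min d q. (\<Prod>i<k. real q - real i) / (real k * real q ^ k))
        \<longleftrightarrow> d \<ge> q \<or> (q > 2 \<and> d = q - 1))
     \<and> avg_cycles TYPE('a) d
        > (\<Sum>k = 1..min d (nat \<lfloor>sqrt (real q)\<rfloor>). 1 / real k) - 1 / 4
     \<and> (d \<ge> 1 \<longrightarrow>
          (\<Sum>k = 1..min d (nat \<lfloor>sqrt (real q)\<rfloor>). 1 / real k) - 1 / 4
          > ln (real (min d (nat \<lfloor>sqrt (real q)\<rfloor>) + 1)) - 1 / 4)"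
proof (intro conjI impI)
  have q: "q \<ge> 2" using CARD_ge_2[where 'a='a] assms by simp
  show ge: "avg_cycles TYPE('a) d
      \<ge> (\<Sum>k = 1..min d q. (\<Prod>i<k. real q - real i) / (real k * real q ^ k))"
    using avg_cycles_ge[where 'a='a and d=d] unfolding assms .
  show "avg_cycles TYPE('a) d
      = (\<Sum>k = 1..min d q. (\<Prod>i<k. real q - real i) / (real k * real q ^ k))
    \<longleftrightarrow> d \<ge> q \<or> (q > 2 \<and> d = q - 1)"
    using avg_cycles_eq_iff[where 'a='a and d=d] no_long_cycle_list_iff[where 'a='a and d=d]
    unfolding assms by simp
  show "avg_cycles TYPE('a) d > (\<Sum>k = 1..min d (nat \<lfloor>sqrt (real q)\<rfloor>). 1 / real k) - 1 / 4"
    using ge sum_falling_factorial_gt[of q d] q by linarith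
  assume "d \<ge> 1"
  moreover have "nat \<lfloor>sqrt (real q)\<rfloor> \<ge> 1"
    using q by (simp add: le_nat_floor)
  ultimately show "(\<Sum>k = 1..min d (nat \<lfloor>sqrt (real q)\<rfloor>). 1 / real k) - 1 / 4
      > ln (real (min d (nat \<lfloor>sqrt (real q)\<rfloor>) + 1)) - 1 / 4"
    using ln_less_sum_inverse[of "min d (nat \<lfloor>sqrt (real q)\<rfloor>)"] by simp
qed

end
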